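(* For every integer $n\ge 1$, the Morse complex of the extended star graph $S_{1,n}$ is homotopy equivalent to the $n$-sphere: \[ \mathcal{M}(S_{1,n})\simeq S^n . \]
   Context: Graphs are regarded as $1$-dimensional simplicial complexes (simplices: vertices and edges). A discrete vector field $V$ on a graph $G$ is a set of pairs $(v,e)$ with $v$ a vertex and $e$ an edge containing $v$, such that every vertex and every edge of $G$ occurs in at most one pair of $V$. A $V$-path is a sequence $v_0,e_0,v_1,e_1,\dots,e_{k-1},v_k$ with $(v_i,e_i)\in V$ and $v_{i+1}\neq v_i$ the other endpoint of $e_i$; it is closed if $v_k=v_0$ and non-trivial if $k\ge1$. $V$ is a gradient vector field if it has no non-trivial closed $V$-path. A primitive gradient vector field is a single pair $\{(v,e)\}$. The Morse complex $\mathcal{M}(G)$ is the simplicial complex whose vertices are the primitive gradient vector fields of $G$, a set of them forming a simplex iff their union is a gradient vector field (i.e. they pairwise share no vertex or edge of $G$ and together contain no non-trivial closed path). Homotopy equivalence refers to geometric realizations. The extended star graph $S_{m,n}$ is the graph obtained as the one-point union, at a common vertex $c$ (the center), of $m$ paths of length $1$ and $n$ paths of length $2$. *)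

theory Defs
  imports "HOL-Analysis.Analysis"
begin

record 'a graph =
  verts :: "'a set"
  edges :: "'a set set"

definition simple_graph :: "'a graph \<Rightarrow> bool" where
  "simple_graph G \<longleftrightarrow> (\<forall>e\<in>edges G. e \<subseteq> verts G \<and> card e = 2)"

definition discrete_vector_field :: "'a graph \<Rightarrow> ('a \<times> 'a set) set \<Rightarrow> bool" where
  "discrete_vector_field G V \<longleftrightarrow>
     (\<forall>(v, e)\<in>V. v \<in> verts G \<and> e \<in> edges G \<and> v \<in> e) \<and>
     (\<forall>(v, e)\<in>V. \<forall>(v', e')\<in>V. v = v' \<or> e = e' \<longrightarrow> (v, e) = (v', e'))"

text \<open>The sequence $v_0, e_0, v_1, \dots, e_{k-1}, v_k$ is given by its list of vertices
  (length $k+1$) and its list of edges (length $k$).\<close>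

definition V_path :: "'a graph \<Rightarrow> ('a \<times> 'a set) set \<Rightarrow> 'a list \<Rightarrow> 'a set list \<Rightarrow> bool" where
  "V_path G V vs es \<longleftrightarrow>
     set vs \<subseteq> verts G \<and> length vs = Suc (length es) \<and>
     (\<forall>i<length es. (vs ! i, es ! i) \<in> V \<and> vs ! Suc i \<noteq> vs ! i \<and> es ! i = {vs ! i, vs ! Suc i})"

definition gradient_vector_field :: "'a graph \<Rightarrow> ('a \<times> 'a set) set \<Rightarrow> bool" where
  "gradient_vector_field G V \<longleftrightarrow>
     discrete_vector_field G V \<and>
     (\<nexists>vs es. V_path G V vs es \<and> length es \<ge> 1 \<and> last vs = hd vs)"

definition primitive_gradient_vector_field :: "'a graph \<Rightarrow> ('a \<times> 'a set) set \<Rightarrow> bool" where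
  "primitive_gradient_vector_field G V \<longleftrightarrow> gradient_vector_field G V \<and> (\<exists>v e. V = {(v, e)})"

definition abstract_simplicial_complex :: "'a set set \<Rightarrow> bool" where
  "abstract_simplicial_complex K \<longleftrightarrow>
     (\<forall>\<sigma>\<in>K. finite \<sigma> \<and> \<sigma> \<noteq> {} \<and> (\<forall>\<tau>\<subseteq>\<sigma>. \<tau> \<noteq> {} \<longrightarrow> \<tau> \<in> K))"

definition morse_complex :: "'a graph \<Rightarrow> ('a \<times> 'a set) set set set" where
  "morse_complex G =
     {\<sigma>. finite \<sigma> \<and> \<sigma> \<noteq> {} \<and> (\<forall>V\<in>\<sigma>. primitive_gradient_vector_field G V) \<and>
         gradient_vector_field G (\<Union>\<sigma>)}"

text \<open>Points are given by their barycentric coordinates, extended by zero to the whole vertex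
  type. The topology is that of pointwise convergence of the coordinates; for a finite complex
  it agrees with the weak topology (for infinite complexes it need not).\<close>

definition geometric_realization :: "'a set set \<Rightarrow> ('a \<Rightarrow> real) topology" where
  "geometric_realization K =
     subtopology (powertop_real UNIV)
       {x. (\<forall>v. 0 \<le> x v) \<and> {v. x v \<noteq> 0} \<in> K \<and> (\<Sum>v | x v \<noteq> 0. x v) = 1}"

text \<open>\<open>Leaf i\<close> is the end of the \<open>i\<close>-th path of length 1; \<open>Inner j\<close> and \<open>Outer j\<close> are the middle
  and the end of the \<open>j\<close>-th path of length 2.\<close>

datatype star_vertex = Center | Leaf nat | Inner nat | Outer nat

definition extended_star :: "nat \<Rightarrow> nat \<Rightarrow> star_vertex graph" where
  "extended_star m n =
     \<lparr>verts = {Center} \<union> Leaf ` {..<m} \<union> Inner ` {..<n} \<union> Outer ` {..<n},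
      edges = (\<lambda>i. {Center, Leaf i}) ` {..<m}
              \<union> (\<lambda>j. {Center, Inner j}) ` {..<n} \<union> (\<lambda>j. {Inner j, Outer j}) ` {..<n}\<rparr>"

lemma simple_graph_extended_star: "simple_graph (extended_star m n)"
  by (auto simp: simple_graph_def extended_star_def)

lemma gradient_vector_field_subset:
  assumes "gradient_vector_field G V" "W \<subseteq> V"
  shows "gradient_vector_field G W"
proof -
  have "discrete_vector_field G W"
    using assms unfolding gradient_vector_field_def discrete_vector_field_def case_prod_beta
    by (meson subsetD)
  moreover have "V_path G V vs es" if "V_path G W vs es" for vs es
    using that assms(2) unfolding V_path_def by blast
  ultimately show ?thesis
    using assms(1) unfolding gradient_vector_field_def by blast
qed

lemma abstract_simplicial_complex_morse_complex: "abstract_simplicial_complex (morse_complex G)"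
proof -
  have "\<tau> \<in> morse_complex G" if "\<sigma> \<in> morse_complex G" "\<tau> \<subseteq> \<sigma>" "\<tau> \<noteq> {}" for \<sigma> \<tau>
  proof -
    have "finite \<tau>"
      using that finite_subset unfolding morse_complex_def by blast
    moreover have "gradient_vector_field G (\<Union>\<tau>)"
      using that gradient_vector_field_subset[of G "\<Union>\<sigma>" "\<Union>\<tau>"] Union_mono[of \<tau> \<sigma>]
      by (simp add: morse_complex_def)
    ultimately show ?thesis
      using that unfolding morse_complex_def by blast
  qed
  moreover have "finite \<sigma> \<and> \<sigma> \<noteq> {}" if "\<sigma> \<in> morse_complex G" for \<sigma>
    using that unfolding morse_complex_def by blast
  ultimately show ?thesis
    unfolding abstract_simplicial_complex_def by blast
qed

lemma primitive_gradient_vector_field_iff: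
  "primitive_gradient_vector_field G V \<longleftrightarrow>
     (\<exists>v e. V = {(v, e)} \<and> v \<in> verts G \<and> e \<in> edges G \<and> v \<in> e)"
proof -
  have "last vs \<noteq> hd vs" if p: "V_path G {(v, e)} vs es" and l: "length es \<ge> 1" for v e vs es
  proof -
    have len: "length vs = Suc (length es)"
      and step: "\<And>i. i < length es \<Longrightarrow> vs ! i = v \<and> vs ! Suc i \<noteq> vs ! i"
      using p unfolding V_path_def by auto
    from l have "0 < length es" "length es - 1 < length es" "Suc (length es - 1) = length es"
      by auto
    then have "vs ! 0 = v" "vs ! length es \<noteq> v"
      using step[of 0] step[of "length es - 1"] by auto
    moreover have "hd vs = vs ! 0" "last vs = vs ! length es"
      using len hd_conv_nth[of vs] last_conv_nth[of vs] by force+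
    ultimately show ?thesis by simp
  qed
  then have "gradient_vector_field G {(v, e)} \<longleftrightarrow> v \<in> verts G \<and> e \<in> edges G \<and> v \<in> e" for v e
    unfolding gradient_vector_field_def discrete_vector_field_def by blast
  then show ?thesis
    unfolding primitive_gradient_vector_field_def by blast
qed

lemma finite_morse_complex:
  assumes "finite (verts G)" "finite (edges G)"
  shows "finite (morse_complex G)"
proof (rule finite_subset)
  show "morse_complex G \<subseteq> Pow (Pow (verts G \<times> edges G))"
    by (auto simp: morse_complex_def gradient_vector_field_def discrete_vector_field_def)
  show "finite (Pow (Pow (verts G \<times> edges G)))"
    using assms by simp
qed

end

theory Submission
  imports Defs
begin

text \<open>On a tree, every discrete vector field is a gradient field, so a set of primitive vectors
  spans a simplex iff its members pairwise share no vertex and no edge. In \<open>S_{1,n}\<close> the vector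
  from \<open>Inner j\<close> to \<open>Center\<close> may be replaced by the one from \<open>Outer j\<close> to \<open>Inner j\<close>, and the vector
  from \<open>Center\<close> to \<open>Inner j\<close> by the one from \<open>Leaf 0\<close> to \<open>Center\<close>. This vertex map is contiguous to
  the identity, and its image is spanned by the \<open>n + 1\<close> pairs of opposite vectors on the leaf edge
  and on the outer edges: it is the boundary of the \<open>(n + 1)\<close>-dimensional cross-polytope.\<close>

section \<open>Geometric realizations\<close>

lemma topspace_geometric_realization:
  "topspace (geometric_realization K) =
     {x. (\<forall>v. 0 \<le> x v) \<and> {v. x v \<noteq> 0} \<in> K \<and> (\<Sum>v | x v \<noteq> 0. x v) = 1}"
  by (simp add: geometric_realization_def)

lemma continuous_map_into_geometric_realization:
  "continuous_map X (geometric_realization K) f \<longleftrightarrow>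
     (\<forall>v. continuous_map X euclideanreal (\<lambda>x. f x v)) \<and>
     f \<in> topspace X \<rightarrow> topspace (geometric_realization K)"
  unfolding topspace_geometric_realization
  unfolding geometric_realization_def continuous_map_in_subtopology continuous_map_componentwise_UNIV
  by auto

lemma continuous_map_geometric_realization_coordinate:
  "continuous_map (geometric_realization K) euclideanreal (\<lambda>x. x v)"
  unfolding geometric_realization_def
  by (rule continuous_map_from_subtopology[OF continuous_map_product_projection]) simp

text \<open>The simplex \<open>S\<close> may be larger than the support: a nonempty subset of a
  simplex is again a simplex, so any carrier of total mass 1 will do.\<close>

lemma geometric_realizationI:
  assumes "abstract_simplicial_complex K" "S \<in> K" "\<And>v. 0 \<le> x v" "\<And>v. v \<notin> S \<Longrightarrow> x v = 0"
    and "sum x S = 1"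
  shows "x \<in> topspace (geometric_realization K)"
proof -
  have fin: "finite S"
    using assms(1,2) by (auto simp: abstract_simplicial_complex_def)
  have sub: "{v. x v \<noteq> 0} \<subseteq> S"
    using assms(4) by blast
  have sum: "(\<Sum>v | x v \<noteq> 0. x v) = 1"
    using sum.mono_neutral_left[OF fin sub, of x] assms(5) by simp
  then have "{v. x v \<noteq> 0} \<noteq> {}"
    by (metis sum.empty zero_neq_one)
  then have "{v. x v \<noteq> 0} \<in> K"
    using assms(1,2) sub unfolding abstract_simplicial_complex_def by blast
  then show ?thesis
    using assms(3) sum by (simp add: topspace_geometric_realization)
qed

lemma sum_geometric_realization:
  assumes "x \<in> topspace (geometric_realization K)" "finite S" "{v. x v \<noteq> 0} \<subseteq> S"
  shows "sum x S = 1"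
  using assms sum.mono_neutral_left[OF assms(2,3), of x] by (simp add: topspace_geometric_realization)

text \<open>Contiguous maps are homotopic: the segment from \<open>f x\<close> to \<open>g x\<close>
  stays in the closed simplex spanned by the union of both supports, so the straight-line homotopy
  \<open>h\<close> never leaves the realization.\<close>

lemma homotopic_geometric_realization_linear:
  assumes K: "abstract_simplicial_complex K"
    and f: "continuous_map X (geometric_realization K) f"
    and g: "continuous_map X (geometric_realization K) g"
    and contig: "\<And>x. x \<in> topspace X \<Longrightarrow> {v. f x v \<noteq> 0} \<union> {v. g x v \<noteq> 0} \<in> K"
  shows "homotopic_with (\<lambda>_. True) X (geometric_realization K) f g"
proof -
  define h where "h = (\<lambda>(t::real, x) v. (1 - t) * f x v + t * g x v)"
  let ?P = "prod_topology (top_of_set {0..1::real}) X"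
  have fst: "continuous_map ?P euclideanreal fst"
    using continuous_map_fst continuous_map_in_subtopology by fastforce
  have cont: "continuous_map ?P euclideanreal (\<lambda>z. h z v)" for v
  proof -
    have "continuous_map ?P euclideanreal (\<lambda>z. f (snd z) v)"
      "continuous_map ?P euclideanreal (\<lambda>z. g (snd z) v)"
      using f g continuous_map_compose[OF continuous_map_snd, of X euclideanreal _ "top_of_set {0..1::real}"]
      by (auto simp: continuous_map_into_geometric_realization o_def)
    then show ?thesis
      unfolding h_def case_prod_beta by (intro continuous_intros fst)
  qed
  have carrier: "h (t, x) \<in> topspace (geometric_realization K)"
    if t: "t \<in> {0..1}" and x: "x \<in> topspace X" for t x
  proof (rule geometric_realizationI[OF K contig[OF x]])
    have fx: "f x \<in> topspace (geometric_realization K)" and gx: "g x \<in> topspace (geometric_realization K)"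
      using f g x by (auto simp: continuous_map_into_geometric_realization)
    show "0 \<le> h (t, x) v" for v
      using t fx gx by (simp add: h_def topspace_geometric_realization)
    let ?S = "{v. f x v \<noteq> 0} \<union> {v. g x v \<noteq> 0}"
    have "finite ?S"
      using K contig[OF x] unfolding abstract_simplicial_complex_def by blast
    then have "sum (f x) ?S = 1" "sum (g x) ?S = 1"
      using sum_geometric_realization[OF fx] sum_geometric_realization[OF gx] by simp_all
    then show "sum (h (t, x)) ?S = 1"
      by (simp add: h_def sum.distrib flip: sum_distrib_left)
  qed (auto simp: h_def)
  have "continuous_map ?P (geometric_realization K) h"
    using cont carrier by (auto simp: continuous_map_into_geometric_realization)
  then show ?thesis
    unfolding homotopic_with_def
    by (intro exI[of _ h]) (auto simp: h_def)
qed

section \<open>Complexes that retract to the boundary of a cross-polytope\<close>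

text \<open>The retraction collapses all of \<open>N i\<close> to \<open>q i\<close>, the vertex opposite to \<open>p i\<close>;
  \<open>insert_q\<close> makes it contiguous to the identity.\<close>

locale crosspolytope_retract =
  fixes K :: "'a set set" and n :: nat and p q :: "nat \<Rightarrow> 'a" and N :: "nat \<Rightarrow> 'a set"
  assumes complex: "abstract_simplicial_complex K"
    and finite_N: "i \<le> n \<Longrightarrow> finite (N i)"
    and p_inj: "i \<le> n \<Longrightarrow> j \<le> n \<Longrightarrow> p i = p j \<Longrightarrow> i = j"
    and q_in_N: "i \<le> n \<Longrightarrow> q i \<in> N i"
    and p_notin_N: "i \<le> n \<Longrightarrow> j \<le> n \<Longrightarrow> p i \<notin> N j"
    and N_disjoint: "i \<le> n \<Longrightarrow> j \<le> n \<Longrightarrow> v \<in> N i \<Longrightarrow> v \<in> N j \<Longrightarrow> i = j"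
    and cover: "\<sigma> \<in> K \<Longrightarrow> v \<in> \<sigma> \<Longrightarrow> \<exists>i\<le>n. v = p i \<or> v \<in> N i"
    and p_excludes_N: "\<sigma> \<in> K \<Longrightarrow> i \<le> n \<Longrightarrow> p i \<in> \<sigma> \<Longrightarrow> \<sigma> \<inter> N i = {}"
    and insert_q: "\<sigma> \<in> K \<Longrightarrow> i \<le> n \<Longrightarrow> \<sigma> \<inter> N i \<noteq> {} \<Longrightarrow> insert (q i) \<sigma> \<in> K"
    and crosspolytope: "I \<subseteq> {..n} \<Longrightarrow> J \<subseteq> {..n} \<Longrightarrow> I \<inter> J = {} \<Longrightarrow> I \<union> J \<noteq> {} \<Longrightarrow> p ` I \<union> q ` J \<in> K"
begin

text \<open>Axis \<open>i\<close> of Euclidean space carries \<open>p i\<close> on its positive half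
  and all of \<open>N i\<close> on its negative half. The value 0 beyond \<open>n\<close> matches
  \<open>nsphere n\<close>, whose points are sequences vanishing there.\<close>

definition coord :: "('a \<Rightarrow> real) \<Rightarrow> nat \<Rightarrow> real" where
  "coord x i = (if i \<le> n then x (p i) - sum x (N i) else 0)"

text \<open>Radial projection of the vector \<open>coord x\<close> onto the unit sphere.\<close>

definition to_sphere :: "('a \<Rightarrow> real) \<Rightarrow> nat \<Rightarrow> real" where
  "to_sphere x i = coord x i / sqrt (\<Sum>k\<le>n. (coord x k)\<^sup>2)"

text \<open>Radial projection onto the unit sphere of the l1 norm, which is the boundary of the
  cross-polytope: the positive part of \<open>y i\<close> becomes the weight of \<open>p i\<close>,
  the negative part that of \<open>q i\<close>. The vertices \<open>p i\<close> and
  \<open>q i\<close> with \<open>i\<close> up to \<open>n\<close> are all distinct, so at most one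
  summand of the numerator is nonzero.\<close>

definition from_sphere :: "(nat \<Rightarrow> real) \<Rightarrow> 'a \<Rightarrow> real" where
  "from_sphere y v =
     (\<Sum>i\<le>n. (if v = p i then max 0 (y i) else 0) + (if v = q i then max 0 (- y i) else 0)) /
     (\<Sum>i\<le>n. \<bar>y i\<bar>)"

lemma p_neq_q: "i \<le> n \<Longrightarrow> j \<le> n \<Longrightarrow> p i \<noteq> q j"
  using p_notin_N q_in_N by metis

lemma q_inj: "i \<le> n \<Longrightarrow> j \<le> n \<Longrightarrow> q i = q j \<Longrightarrow> i = j"
  using q_in_N N_disjoint by metis

lemma coord_pos:
  assumes "x \<in> topspace (geometric_realization K)" "coord x i > 0"
  shows "x (p i) \<noteq> 0"
proof -
  have "0 \<le> sum x (N i)"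
    using assms(1) by (intro sum_nonneg) (simp add: topspace_geometric_realization)
  then show ?thesis
    using assms(2) by (auto simp: coord_def split: if_splits)
qed

lemma coord_neg:
  assumes "x \<in> topspace (geometric_realization K)" "coord x i < 0"
  shows "\<exists>v\<in>N i. x v \<noteq> 0"
proof (rule ccontr)
  assume "\<not> ?thesis"
  then have "sum x (N i) = 0"
    by simp
  moreover have "0 \<le> x (p i)"
    using assms(1) by (simp add: topspace_geometric_realization)
  ultimately show False
    using assms(2) by (simp add: coord_def split: if_splits)
qed

text \<open>No cancellation can occur in \<open>coord\<close>: by \<open>p_excludes_N\<close> the
  support of \<open>x\<close> never contains \<open>p i\<close> together with an element of
  \<open>N i\<close>. Hence any vertex of positive weight makes its own axis nonzero.\<close>

lemma coord_nonzero:
  assumes x: "x \<in> topspace (geometric_realization K)"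
  shows "\<exists>i\<le>n. coord x i \<noteq> 0"
proof -
  have nonneg: "\<And>v. 0 \<le> x v" and supp: "{v. x v \<noteq> 0} \<in> K"
    using x by (auto simp: topspace_geometric_realization)
  have "{v. x v \<noteq> 0} \<noteq> {}"
    using complex supp unfolding abstract_simplicial_complex_def by metis
  then obtain v where v: "x v \<noteq> 0"
    by blast
  then obtain i where i: "i \<le> n" "v = p i \<or> v \<in> N i"
    using cover[OF supp] by blast
  have zero: "sum x (N i) = 0" if "x (p i) \<noteq> 0"
    using p_excludes_N[OF supp i(1)] that by (intro sum.neutral) auto
  have "coord x i \<noteq> 0"
  proof (cases "x (p i) = 0")
    case True
    then have "v \<in> N i"
      using i v by auto
    then have "sum x (N i) > 0"
      using v nonneg finite_N[OF i(1)] by (intro sum_pos2[of _ v]) (auto simp: order_less_le)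
    then show ?thesis
      using True i by (simp add: coord_def)
  next
    case False
    then show ?thesis
      using zero i by (simp add: coord_def)
  qed
  then show ?thesis
    using i by blast
qed

lemma coord_norm_pos:
  assumes "x \<in> topspace (geometric_realization K)"
  shows "(\<Sum>k\<le>n. (coord x k)\<^sup>2) > 0"
proof -
  obtain i where "i \<le> n" "coord x i \<noteq> 0"
    using coord_nonzero[OF assms] by blast
  then show ?thesis
    by (intro sum_pos2[of _ i]) auto
qed

section \<open>Well-definedness and continuity of the two maps\<close>

lemma continuous_map_to_sphere:
  "continuous_map (geometric_realization K) (nsphere n) to_sphere"
proof -
  have coord: "continuous_map (geometric_realization K) euclideanreal (\<lambda>x. coord x i)" for i
    unfolding coord_def
    by (cases "i \<le> n")
       (auto intro!: continuous_intros continuous_map_geometric_realization_coordinate finite_N)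
  have sqrt: "continuous_map (geometric_realization K) euclideanreal
      (\<lambda>x. sqrt (\<Sum>k\<le>n. (coord x k)\<^sup>2))"
    by (intro continuous_intros coord) auto
  have "continuous_map (geometric_realization K) euclideanreal (\<lambda>x. to_sphere x i)" for i
    unfolding to_sphere_def using coord_norm_pos
    by (intro continuous_map_real_divide coord sqrt) fastforce
  moreover have "(\<Sum>i\<le>n. (to_sphere x i)\<^sup>2) = 1" if "x \<in> topspace (geometric_realization K)" for x
    using coord_norm_pos[OF that]
    by (simp add: to_sphere_def power_divide sum_nonneg flip: sum_divide_distrib)
  ultimately show ?thesis
    unfolding nsphere continuous_map_in_subtopology continuous_map_componentwise_UNIV
    by (auto simp: to_sphere_def coord_def)
qed

lemma sphere_l1_norm_pos:
  assumes "y \<in> topspace (nsphere n)"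
  shows "(\<Sum>i\<le>n. \<bar>y i\<bar>) > 0"
proof -
  have "(\<Sum>i\<le>n. (y i)\<^sup>2) = 1"
    using assms by (simp add: nsphere)
  then obtain i where "i \<le> n" "y i \<noteq> 0"
    by (metis (mono_tags, lifting) atMost_iff power_zero_numeral sum.neutral zero_neq_one)
  then show ?thesis
    by (intro sum_pos2[of _ i]) auto
qed

lemma from_sphere_p:
  assumes "i \<le> n"
  shows "from_sphere y (p i) = max 0 (y i) / (\<Sum>i\<le>n. \<bar>y i\<bar>)"
proof -
  have "(\<Sum>k\<le>n. (if p i = p k then max 0 (y k) else 0) + (if p i = q k then max 0 (- y k) else 0)) =
        (\<Sum>k\<le>n. if i = k then max 0 (y k) else 0)"
    using assms p_inj p_neq_q by (intro sum.cong refl) auto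
  then show ?thesis
    using assms by (simp add: from_sphere_def)
qed

lemma from_sphere_q:
  assumes "i \<le> n"
  shows "from_sphere y (q i) = max 0 (- y i) / (\<Sum>i\<le>n. \<bar>y i\<bar>)"
proof -
  have "(\<Sum>k\<le>n. (if q i = p k then max 0 (y k) else 0) + (if q i = q k then max 0 (- y k) else 0)) =
        (\<Sum>k\<le>n. if i = k then max 0 (- y k) else 0)"
  proof (intro sum.cong refl)
    fix k assume "k \<in> {..n}"
    then show "(if q i = p k then max 0 (y k) else 0) + (if q i = q k then max 0 (- y k) else 0) =
               (if i = k then max 0 (- y k) else 0)"
      using assms q_inj[of i k] p_neq_q[of k i] by auto
  qed
  then show ?thesis
    using assms by (simp add: from_sphere_def)
qed

lemma from_sphere_eq_0:
  assumes "\<And>i. i \<le> n \<Longrightarrow> y i > 0 \<Longrightarrow> v \<noteq> p i" "\<And>i. i \<le> n \<Longrightarrow> y i < 0 \<Longrightarrow> v \<noteq> q i"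
  shows "from_sphere y v = 0"
proof -
  have "(if v = p i then max 0 (y i) else 0) + (if v = q i then max 0 (- y i) else 0) = 0"
    if "i \<in> {..n}" for i
    using that assms[of i] by (auto simp: max_def)
  then show ?thesis
    by (simp add: from_sphere_def)
qed

lemma from_sphere_in_realization:
  assumes y: "y \<in> topspace (nsphere n)"
  shows "from_sphere y \<in> topspace (geometric_realization K)"
proof -
  define s where "s = (\<Sum>i\<le>n. \<bar>y i\<bar>)"
  have s: "s > 0"
    using sphere_l1_norm_pos[OF y] by (simp add: s_def)
  \<comment> \<open>The signs of \<open>y\<close> select the face of the cross-polytope that carries
    \<open>from_sphere y\<close>.\<close>
  define I where "I = {i\<in>{..n}. y i > 0}"
  define J where "J = {i\<in>{..n}. y i < 0}"
  have fin: "finite I" "finite J"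
    by (simp_all add: I_def J_def)
  have "s = (\<Sum>i\<in>I \<union> J. \<bar>y i\<bar>)"
    unfolding s_def by (rule sum.mono_neutral_right) (auto simp: I_def J_def)
  also have "\<dots> = (\<Sum>i\<in>I. \<bar>y i\<bar>) + (\<Sum>i\<in>J. \<bar>y i\<bar>)"
    using fin by (intro sum.union_disjoint) (auto simp: I_def J_def)
  finally have s_eq: "s = (\<Sum>i\<in>I. \<bar>y i\<bar>) + (\<Sum>i\<in>J. \<bar>y i\<bar>)" .
  have "p ` I \<union> q ` J \<in> K"
  proof (rule crosspolytope)
    show "I \<union> J \<noteq> {}"
      using s s_eq by auto
  qed (auto simp: I_def J_def)
  then show ?thesis
  proof (rule geometric_realizationI[OF complex])
    show "0 \<le> from_sphere y v" for v
      unfolding from_sphere_def by (intro divide_nonneg_nonneg sum_nonneg) auto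
    show "from_sphere y v = 0" if "v \<notin> p ` I \<union> q ` J" for v
      using that by (intro from_sphere_eq_0) (auto simp: I_def J_def)
    have "sum (from_sphere y) (p ` I \<union> q ` J) =
        sum (from_sphere y) (p ` I) + sum (from_sphere y) (q ` J)"
      using fin p_neq_q by (intro sum.union_disjoint) (auto simp: I_def J_def)
    also have "sum (from_sphere y) (p ` I) = (\<Sum>i\<in>I. from_sphere y (p i))"
      using p_inj by (intro sum.reindex_cong[OF _ refl refl]) (auto simp: inj_on_def I_def)
    also have "sum (from_sphere y) (q ` J) = (\<Sum>i\<in>J. from_sphere y (q i))"
      using q_inj by (intro sum.reindex_cong[OF _ refl refl]) (auto simp: inj_on_def J_def)
    also have "(\<Sum>i\<in>I. from_sphere y (p i)) = (\<Sum>i\<in>I. \<bar>y i\<bar> / s)"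
      by (intro sum.cong refl) (auto simp: I_def from_sphere_p s_def)
    also have "(\<Sum>i\<in>J. from_sphere y (q i)) = (\<Sum>i\<in>J. \<bar>y i\<bar> / s)"
      by (intro sum.cong refl) (auto simp: J_def from_sphere_q s_def)
    finally show "sum (from_sphere y) (p ` I \<union> q ` J) = 1"
      using s s_eq by (simp flip: sum_divide_distrib add_divide_distrib)
  qed
qed

lemma continuous_map_from_sphere:
  "continuous_map (nsphere n) (geometric_realization K) from_sphere"
proof -
  have proj: "continuous_map (nsphere n) euclideanreal (\<lambda>y. y i)" for i
    unfolding nsphere
    by (rule continuous_map_from_subtopology[OF continuous_map_product_projection]) simp
  have num: "continuous_map (nsphere n) euclideanreal
      (\<lambda>y. (if v = p i then max 0 (y i) else 0) + (if v = q i then max 0 (- y i) else 0))" for v i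
    by (cases "v = p i"; cases "v = q i") (auto intro!: continuous_intros proj)
  have "continuous_map (nsphere n) euclideanreal (\<lambda>y. from_sphere y v)" for v
    unfolding from_sphere_def
    using sphere_l1_norm_pos
    by (intro continuous_map_real_divide continuous_map_sum num continuous_map_real_abs proj) fastforce+
  then show ?thesis
    using from_sphere_in_realization by (auto simp: continuous_map_into_geometric_realization)
qed

text \<open>The two normalizations cancel: \<open>coord\<close> recovers \<open>y\<close> divided by
  its l1 norm, and Euclidean normalization gives back \<open>y\<close>, which already had norm
  1.\<close>

lemma to_sphere_from_sphere:
  assumes y: "y \<in> topspace (nsphere n)"
  shows "to_sphere (from_sphere y) = y"
proof
  fix i
  define s where "s = (\<Sum>i\<le>n. \<bar>y i\<bar>)"
  have s: "s > 0"
    using sphere_l1_norm_pos[OF y] by (simp add: s_def)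
  have sphere: "(\<Sum>i\<le>n. (y i)\<^sup>2) = 1" "\<And>i. i > n \<Longrightarrow> y i = 0"
    using y by (auto simp: nsphere)
  have coord: "coord (from_sphere y) k = y k / s" if k: "k \<le> n" for k
  proof -
    \<comment> \<open>Within \<open>N k\<close> only \<open>q k\<close> can carry mass, since
      \<open>N k\<close> contains no \<open>p i\<close> and no \<open>q i\<close> of another
      index.\<close>
    have "sum (from_sphere y) (N k) = (\<Sum>v\<in>N k. if v = q k then from_sphere y v else 0)"
    proof (intro sum.cong refl)
      fix v assume v: "v \<in> N k"
      have "from_sphere y v = 0" if "v \<noteq> q k"
        using that v k p_notin_N q_in_N N_disjoint by (intro from_sphere_eq_0) metis+
      then show "from_sphere y v = (if v = q k then from_sphere y v else 0)"
        by simp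
    qed
    also have "\<dots> = from_sphere y (q k)"
      using k finite_N q_in_N by simp
    finally show ?thesis
      using k by (auto simp: coord_def from_sphere_p from_sphere_q max_def simp flip: s_def)
  qed
  have "(\<Sum>k\<le>n. (coord (from_sphere y) k)\<^sup>2) = (\<Sum>k\<le>n. (y k / s)\<^sup>2)"
    using coord by (intro sum.cong refl) simp
  also have "\<dots> = (1 / s)\<^sup>2"
    using sphere by (simp add: power_divide flip: sum_divide_distrib)
  finally have "sqrt (\<Sum>k\<le>n. (coord (from_sphere y) k)\<^sup>2) = 1 / s"
    using s by (simp add: real_sqrt_divide power_divide)
  then show "to_sphere (from_sphere y) i = y i"
    using s coord sphere by (cases "i \<le> n") (auto simp: to_sphere_def coord_def)
qed

section \<open>Contiguity of the retraction with the identity\<close>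

lemma union_q_in_K:
  assumes "finite J" "J \<subseteq> {i\<in>{..n}. \<sigma> \<inter> N i \<noteq> {}}" "\<sigma> \<in> K"
  shows "\<sigma> \<union> q ` J \<in> K"
  using assms
proof (induction J)
  case (insert i J)
  then have "insert (q i) (\<sigma> \<union> q ` J) \<in> K"
    by (intro insert_q) auto
  then show ?case
    by simp
qed simp

text \<open>The image of \<open>x\<close> uses only vertices \<open>p i\<close> already in its
  support and vertices \<open>q i\<close> for which the support meets \<open>N i\<close>. Adding all
  the latter still gives a simplex, by repeated use of \<open>insert_q\<close>.\<close>

lemma from_sphere_to_sphere_contiguous:
  assumes x: "x \<in> topspace (geometric_realization K)"
  shows "{v. from_sphere (to_sphere x) v \<noteq> 0} \<union> {v. x v \<noteq> 0} \<in> K"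
proof -
  let ?\<sigma> = "{v. x v \<noteq> 0}"
  define J where "J = {i\<in>{..n}. ?\<sigma> \<inter> N i \<noteq> {}}"
  have "?\<sigma> \<in> K"
    using x by (simp add: topspace_geometric_realization)
  then have big: "?\<sigma> \<union> q ` J \<in> K"
    by (intro union_q_in_K) (auto simp: J_def)
  have "v \<in> ?\<sigma> \<union> q ` J" if v: "from_sphere (to_sphere x) v \<noteq> 0" for v
  proof -
    \<comment> \<open>Dividing by the positive norm preserves signs, so the sign of
      \<open>coord\<close> decides which vertices appear.\<close>
    have sgn: "to_sphere x i > 0 \<longleftrightarrow> coord x i > 0" "to_sphere x i < 0 \<longleftrightarrow> coord x i < 0" for i
      using coord_norm_pos[OF x] by (auto simp: to_sphere_def zero_less_divide_iff divide_less_0_iff)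
    obtain i where "i \<le> n" "coord x i > 0 \<and> v = p i \<or> coord x i < 0 \<and> v = q i"
      using v from_sphere_eq_0[of "to_sphere x" v] sgn by metis
    then show ?thesis
      using coord_pos[OF x, of i] coord_neg[OF x, of i] by (auto simp: J_def)
  qed
  then have "{v. from_sphere (to_sphere x) v \<noteq> 0} \<union> ?\<sigma> \<subseteq> ?\<sigma> \<union> q ` J"
    by blast
  moreover have "?\<sigma> \<noteq> {}"
    using \<open>?\<sigma> \<in> K\<close> complex unfolding abstract_simplicial_complex_def by blast
  ultimately show ?thesis
    using big complex unfolding abstract_simplicial_complex_def by (meson Un_empty)
qed

theorem homotopy_equivalent_nsphere:
  "geometric_realization K homotopy_equivalent_space nsphere n"
  unfolding homotopy_equivalent_space_def
proof (intro exI conjI)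
  show "continuous_map (geometric_realization K) (nsphere n) to_sphere"
    by (rule continuous_map_to_sphere)
  show "continuous_map (nsphere n) (geometric_realization K) from_sphere"
    by (rule continuous_map_from_sphere)
  show "homotopic_with (\<lambda>_. True) (geometric_realization K) (geometric_realization K)
      (from_sphere \<circ> to_sphere) id"
    using continuous_map_compose[OF continuous_map_to_sphere continuous_map_from_sphere]
      from_sphere_to_sphere_contiguous
    by (intro homotopic_geometric_realization_linear complex) auto
  show "homotopic_with (\<lambda>_. True) (nsphere n) (nsphere n) (to_sphere \<circ> from_sphere) id"
    using continuous_map_compose[OF continuous_map_from_sphere continuous_map_to_sphere]
    by (intro homotopic_with_equal) (auto simp: to_sphere_from_sphere)
qed

end

section \<open>The Morse complex of the extended star\<close>

text \<open>A rank that strictly increases from each vector of a path to the next cannot return to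
  its initial value. It need only increase when the edge changes, because a discrete vector field
  never lets a path turn back along the edge just used.\<close>

lemma gradient_vector_field_rank:
  fixes rank :: "'a \<times> 'a set \<Rightarrow> nat"
  assumes V: "discrete_vector_field G V"
    and rank: "\<And>v w e. (v, {v, w}) \<in> V \<Longrightarrow> (w, e) \<in> V \<Longrightarrow> w \<noteq> v \<Longrightarrow> e \<noteq> {v, w} \<Longrightarrow>
                 rank (v, {v, w}) < rank (w, e)"
  shows "gradient_vector_field G V"
proof -
  have False if path: "V_path G V vs es" and k: "length es \<ge> 1" and closed: "last vs = hd vs" for vs es
  proof -
    define k where "k = length es"
    have k_pos: "0 < k"
      using k unfolding k_def by linarith
    have step: "(vs ! i, es ! i) \<in> V" "vs ! Suc i \<noteq> vs ! i" "es ! i = {vs ! i, vs ! Suc i}"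
      if "i < k" for i
      using path that by (auto simp: V_path_def k_def)
    have wrap: "vs ! k = vs ! 0"
      using path closed hd_conv_nth[of vs] last_conv_nth[of vs] by (force simp: V_path_def k_def)
    \<comment> \<open>Keeping \<open>j\<close> apart from \<open>Suc i\<close> lets the same fact
      cover the closing step, from index \<open>k - 1\<close> back to 0.\<close>
    have less: "rank (vs ! i, es ! i) < rank (vs ! j, es ! j)"
      if i: "i < k" and j: "j < k" "vs ! Suc i = vs ! j" for i j
    proof -
      have "es ! j \<noteq> es ! i"
      proof
        \<comment> \<open>Equal edges would be paired with equal vertices, making the path
          stationary.\<close>
        assume "es ! j = es ! i"
        then have "vs ! i = vs ! j"
          using V step(1)[OF i] step(1)[OF j(1)] unfolding discrete_vector_field_def by fastforce
        then show False
          using step(2)[OF i] j by simp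
      qed
      then show ?thesis
        using rank[of "vs ! i" "vs ! j" "es ! j"] step[OF i] step(1)[OF j(1)] j(2) by auto
    qed
    have "rank (vs ! 0, es ! 0) \<le> rank (vs ! i, es ! i)" if "i < k" for i
      using that
    proof (induction i)
      case (Suc i)
      then show ?case
        using less[of i "Suc i"] by simp
    qed simp
    moreover have "rank (vs ! (k - 1), es ! (k - 1)) < rank (vs ! 0, es ! 0)"
      using k_pos wrap by (intro less) simp_all
    ultimately show False
      using k_pos by (metis diff_less leD zero_less_one)
  qed
  then show ?thesis
    using V unfolding gradient_vector_field_def by blast
qed

text \<open>Along a path in the star that never turns back, the edges lead first towards the center
  and then away from it.\<close>

fun star_rank :: "star_vertex \<times> star_vertex set \<Rightarrow> nat" where
  "star_rank (Outer j, e) = 0"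
| "star_rank (Leaf i, e) = 1"
| "star_rank (Center, e) = 2"
| "star_rank (Inner j, e) = (if Center \<in> e then 1 else 3)"

lemma star_vector_cases:
  assumes "e \<in> edges (extended_star m n)" "v \<in> e"
  obtains (leaf_out) i where "i < m" "v = Center" "e = {Center, Leaf i}"
    | (leaf_in) i where "i < m" "v = Leaf i" "e = {Center, Leaf i}"
    | (inner_out) j where "j < n" "v = Center" "e = {Center, Inner j}"
    | (inner_in) j where "j < n" "v = Inner j" "e = {Center, Inner j}"
    | (outer_out) j where "j < n" "v = Inner j" "e = {Inner j, Outer j}"
    | (outer_in) j where "j < n" "v = Outer j" "e = {Inner j, Outer j}"
proof -
  consider i where "i < m" "e = {Center, Leaf i}" | j where "j < n" "e = {Center, Inner j}"
    | j where "j < n" "e = {Inner j, Outer j}"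
    using assms(1) by (auto simp: extended_star_def)
  then show thesis
    using assms(2) that by cases auto
qed

text \<open>\<open>star_rank\<close> rules out closed paths, so acyclicity is automatic and only the
  matching condition remains.\<close>

lemma gradient_vector_field_extended_star:
  "gradient_vector_field (extended_star m n) V \<longleftrightarrow> discrete_vector_field (extended_star m n) V"
proof
  assume V: "discrete_vector_field (extended_star m n) V"
  have edge: "e \<in> edges (extended_star m n) \<and> v \<in> e" if "(v, e) \<in> V" for v e
    using V that unfolding discrete_vector_field_def by blast
  show "gradient_vector_field (extended_star m n) V"
  proof (rule gradient_vector_field_rank[OF V, of star_rank])
    fix v w e
    assume "(v, {v, w}) \<in> V" "(w, e) \<in> V" and ne: "w \<noteq> v" "e \<noteq> {v, w}"
    then have "{v, w} \<in> edges (extended_star m n)" "e \<in> edges (extended_star m n)" "w \<in> e"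
      using edge by blast+
    note * = star_vector_cases[OF this(1) insertI1] star_vector_cases[OF this(2,3)]
    show "star_rank (v, {v, w}) < star_rank (w, e)"
      \<comment> \<open>Each pair of vector types either cannot be consecutive without turning back
        or has increasing rank.\<close>
      by (rule *(1); rule *(2); use ne in \<open>simp add: doubleton_eq_iff\<close>)
  qed
qed (simp add: gradient_vector_field_def)

text \<open>The non-adjacency relation of the Morse complex of a star, which is a flag complex: its
  simplices are the nonempty conflict-free sets of vectors.\<close>

definition conflict :: "'a \<times> 'a set \<Rightarrow> 'a \<times> 'a set \<Rightarrow> bool" where
  "conflict a b \<longleftrightarrow> a \<noteq> b \<and> (fst a = fst b \<or> snd a = snd b)"

lemma conflict_sym: "conflict a b \<Longrightarrow> conflict b a"
  by (auto simp: conflict_def)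

lemma morse_complex_extended_star_iff:
  "\<sigma> \<in> morse_complex (extended_star m n) \<longleftrightarrow>
     finite \<sigma> \<and> \<sigma> \<noteq> {} \<and>
     \<sigma> \<subseteq> (\<lambda>a. {a}) ` {(v, e). e \<in> edges (extended_star m n) \<and> v \<in> e} \<and>
     (\<forall>a b. {a} \<in> \<sigma> \<longrightarrow> {b} \<in> \<sigma> \<longrightarrow> \<not> conflict a b)"
proof -
  let ?G = "extended_star m n"
  let ?A = "{(v, e). e \<in> edges ?G \<and> v \<in> e}"
  have verts: "v \<in> verts ?G" if "e \<in> edges ?G" "v \<in> e" for v e
    using simple_graph_extended_star[of m n] that unfolding simple_graph_def by blast
  have prim: "(\<forall>V\<in>\<sigma>. primitive_gradient_vector_field ?G V) \<longleftrightarrow> \<sigma> \<subseteq> (\<lambda>a. {a}) ` ?A"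
    using verts unfolding primitive_gradient_vector_field_iff by auto
  have "discrete_vector_field ?G (\<Union>\<sigma>) \<longleftrightarrow> (\<forall>a b. {a} \<in> \<sigma> \<longrightarrow> {b} \<in> \<sigma> \<longrightarrow> \<not> conflict a b)"
    if \<sigma>: "\<sigma> \<subseteq> (\<lambda>a. {a}) ` ?A"
  proof -
    have mem: "a \<in> \<Union>\<sigma> \<longleftrightarrow> {a} \<in> \<sigma>" for a
      using \<sigma> by blast
    have "a \<in> ?A" if "{a} \<in> \<sigma>" for a
      using \<sigma> that by blast
    then have "v \<in> verts ?G \<and> e \<in> edges ?G \<and> v \<in> e" if "{(v, e)} \<in> \<sigma>" for v e
      using verts that by blast
    then show ?thesis
      unfolding discrete_vector_field_def Ball_def mem conflict_def split_paired_all split_paired_All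
        case_prod_conv fst_conv snd_conv by metis
  qed
  then show ?thesis
    unfolding morse_complex_def gradient_vector_field_extended_star mem_Collect_eq prim by blast
qed

text \<open>Index 0 stands for the leaf edge and \<open>Suc j\<close> for the \<open>j\<close>-th
  outer edge. On these edges \<open>pos_vector\<close> points away from the center and
  \<open>neg_vector\<close> towards it.\<close>

fun pos_vector :: "nat \<Rightarrow> star_vertex \<times> star_vertex set" where
  "pos_vector 0 = (Center, {Center, Leaf 0})"
| "pos_vector (Suc j) = (Inner j, {Inner j, Outer j})"

fun neg_vector :: "nat \<Rightarrow> star_vertex \<times> star_vertex set" where
  "neg_vector 0 = (Leaf 0, {Center, Leaf 0})"
| "neg_vector (Suc j) = (Outer j, {Inner j, Outer j})"

text \<open>For \<open>i\<close> up to \<open>n\<close> these are exactly the vectors of the star in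
  conflict with \<open>pos_vector i\<close>. The two vectors on an inner edge are thereby separated:
  the outward one goes to class 0, the inward one to class \<open>Suc j\<close>.\<close>

fun neg_class :: "nat \<Rightarrow> nat \<Rightarrow> (star_vertex \<times> star_vertex set) set" where
  "neg_class n 0 = insert (neg_vector 0) ((\<lambda>j. (Center, {Center, Inner j})) ` {..<n})"
| "neg_class n (Suc j) = {neg_vector (Suc j), (Inner j, {Center, Inner j})}"

lemma star_vectors_eq:
  "{(v, e). e \<in> edges (extended_star 1 n) \<and> v \<in> e} =
     pos_vector ` {..n} \<union> (\<Union>i\<le>n. neg_class n i)"
proof (intro equalityI subsetI)
  fix a assume "a \<in> {(v, e). e \<in> edges (extended_star 1 n) \<and> v \<in> e}"
  then obtain v e where a: "a = (v, e)" and e: "e \<in> edges (extended_star 1 n)" "v \<in> e"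
    by blast
  have "\<exists>i\<le>n. a = pos_vector i \<or> a \<in> neg_class n i"
    using e
  proof (cases rule: star_vector_cases)
    case (inner_in j)
    then show ?thesis
      using a by (intro exI[of _ "Suc j"]) simp
  next
    case (outer_out j)
    then show ?thesis
      using a by (intro exI[of _ "Suc j"]) simp
  next
    case (outer_in j)
    then show ?thesis
      using a by (intro exI[of _ "Suc j"]) simp
  qed (use a in \<open>auto intro!: exI[of _ 0]\<close>)
  then show "a \<in> pos_vector ` {..n} \<union> (\<Union>i\<le>n. neg_class n i)"
    by blast
next
  fix a assume "a \<in> pos_vector ` {..n} \<union> (\<Union>i\<le>n. neg_class n i)"
  then obtain i where i: "i \<le> n" "a = pos_vector i \<or> a \<in> neg_class n i"
    by blast
  then show "a \<in> {(v, e). e \<in> edges (extended_star 1 n) \<and> v \<in> e}"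
    by (cases i) (auto simp: extended_star_def)
qed

section \<open>Incidences and conflicts among the classes\<close>

lemma neg_vector_in_class: "neg_vector i \<in> neg_class n i"
  by (cases i) auto

lemma pos_vector_inj: "pos_vector i = pos_vector j \<Longrightarrow> i = j"
  by (cases i; cases j) auto

lemma pos_vector_notin_class: "pos_vector i \<notin> neg_class n j"
  by (cases i; cases j) (auto simp: doubleton_eq_iff)

lemma neg_class_disjoint: "a \<in> neg_class n i \<Longrightarrow> a \<in> neg_class n j \<Longrightarrow> i = j"
  by (cases i; cases j) (auto simp: doubleton_eq_iff)

lemma conflict_pos_neg_class: "a \<in> neg_class n i \<Longrightarrow> conflict (pos_vector i) a"
  by (cases i) (auto simp: conflict_def doubleton_eq_iff)

lemma not_conflict_pos_pos: "\<not> conflict (pos_vector i) (pos_vector j)"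
  by (cases i; cases j) (simp_all add: conflict_def doubleton_eq_iff)

text \<open>The vector \<open>neg_vector i\<close> starts at an end of the star, where no other
  vector starts, and the only other vector on its edge is \<open>pos_vector i\<close>, which lies in
  no class.\<close>

lemma not_conflict_neg_vector_class:
  assumes "a \<in> neg_class n j"
  shows "\<not> conflict (neg_vector i) a"
proof -
  have "\<forall>a\<in>neg_class n j. \<not> conflict (neg_vector i) a"
    by (cases i; cases j) (simp_all add: conflict_def doubleton_eq_iff)
  then show ?thesis
    using assms by blast
qed

lemma conflict_neg_vector_pos: "conflict (neg_vector i) (pos_vector j) \<Longrightarrow> i = j"
  by (cases i; cases j) (simp_all add: conflict_def doubleton_eq_iff)

text \<open>The decisive condition is \<open>insert_q\<close>: the only possible conflict of
  \<open>neg_vector i\<close> is with \<open>pos_vector i\<close>, and a simplex meeting class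
  \<open>i\<close> cannot contain that vector.\<close>

lemma crosspolytope_retract_morse_complex:
  "crosspolytope_retract (morse_complex (extended_star 1 n)) n
     (\<lambda>i. {pos_vector i}) (\<lambda>i. {neg_vector i}) (\<lambda>i. (\<lambda>a. {a}) ` neg_class n i)"
    (is "crosspolytope_retract ?K n ?p ?q ?N")
proof
  note iff = morse_complex_extended_star_iff[of _ 1 n, unfolded star_vectors_eq]
  show "abstract_simplicial_complex ?K"
    by (rule abstract_simplicial_complex_morse_complex)
  show "finite (?N i)" for i
    by (cases i) auto
  show "i = j" if "?p i = ?p j" for i j
    using that pos_vector_inj by simp
  show "?q i \<in> ?N i" for i
    using neg_vector_in_class by blast
  show "?p i \<notin> ?N j" for i j
    using pos_vector_notin_class by blast
  show "i = j" if "v \<in> ?N i" "v \<in> ?N j" for i j v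
    using that neg_class_disjoint by blast
  show "\<exists>i\<le>n. v = ?p i \<or> v \<in> ?N i" if "\<sigma> \<in> ?K" "v \<in> \<sigma>" for \<sigma> v
    using that unfolding iff by blast
  show excl: "\<sigma> \<inter> ?N i = {}" if "\<sigma> \<in> ?K" "?p i \<in> \<sigma>" for \<sigma> i
    using that conflict_pos_neg_class unfolding iff by blast
  show "insert (?q i) \<sigma> \<in> ?K" if \<sigma>: "\<sigma> \<in> ?K" and i: "i \<le> n" and N: "\<sigma> \<inter> ?N i \<noteq> {}" for \<sigma> i
  proof -
    have "\<not> conflict (neg_vector i) b" if b: "{b} \<in> \<sigma>" for b
    proof
      assume c: "conflict (neg_vector i) b"
      from \<sigma> b have "b \<in> pos_vector ` {..n} \<union> (\<Union>i\<le>n. neg_class n i)"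
        unfolding iff by blast
      \<comment> \<open>A vector in some class would not conflict with \<open>neg_vector i\<close>,
        and among the positive vectors only the one of the same index does.\<close>
      then have "b = pos_vector i"
        using c not_conflict_neg_vector_class conflict_neg_vector_pos by blast
      then show False
        using excl[OF \<sigma>, of i] b N by blast
    qed
    moreover have "\<not> conflict (neg_vector i) (neg_vector i)"
      by (simp add: conflict_def)
    ultimately have "\<not> conflict a b" if "{a} \<in> insert (?q i) \<sigma>" "{b} \<in> insert (?q i) \<sigma>" for a b
      using that \<sigma> conflict_sym unfolding iff by blast
    moreover have "?q i \<in> (\<lambda>a. {a}) ` (pos_vector ` {..n} \<union> (\<Union>i\<le>n. neg_class n i))"
      using i neg_vector_in_class[of i n] by blast
    ultimately show ?thesis
      using \<sigma> unfolding iff by simp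
  qed
  show "?p ` I \<union> ?q ` J \<in> ?K"
    if IJ: "I \<subseteq> {..n}" "J \<subseteq> {..n}" "I \<inter> J = {}" "I \<union> J \<noteq> {}" for I J
    unfolding iff
  proof (intro conjI allI impI)
    show "finite (?p ` I \<union> ?q ` J)"
      using IJ finite_subset by blast
    show "?p ` I \<union> ?q ` J \<subseteq> (\<lambda>a. {a}) ` (pos_vector ` {..n} \<union> (\<Union>i\<le>n. neg_class n i))"
      using IJ(1,2) neg_vector_in_class[of _ n] by blast
    fix a b
    assume "{a} \<in> ?p ` I \<union> ?q ` J" "{b} \<in> ?p ` I \<union> ?q ` J"
    then have "a \<in> pos_vector ` I \<union> neg_vector ` J" "b \<in> pos_vector ` I \<union> neg_vector ` J"
      by auto
    moreover have "\<not> conflict (neg_vector i) (neg_vector j)" for i j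
      by (rule not_conflict_neg_vector_class[OF neg_vector_in_class])
    moreover have "\<not> conflict (neg_vector j) (pos_vector i)" "\<not> conflict (pos_vector i) (neg_vector j)"
      if "i \<in> I" "j \<in> J" for i j
      using IJ(3) that conflict_neg_vector_pos[of j i] conflict_sym[of "pos_vector i" "neg_vector j"]
      by auto
    ultimately show "\<not> conflict a b"
      using not_conflict_pos_pos by auto
  qed (use IJ in auto)
qed

theorem theorem3p12:
  fixes n :: nat
  assumes "n \<ge> 1"
  shows "geometric_realization (morse_complex (extended_star 1 n)) homotopy_equivalent_space nsphere n"
  by (rule crosspolytope_retract.homotopy_equivalent_nsphere[OF crosspolytope_retract_morse_complex])

end
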